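(* If a finite directed acyclic graph $D$ has a fractional pebbling using $p$ pebbles, then $D$ has a whole black-white pebbling using $2p$ pebbles.
   Context: For a DAG, the children of a node $i$ are the nodes with an edge into $i$; leaves are nodes with no children; sinks (nodes with no outgoing edges) play the role of roots. A fractional configuration assigns to each node $i$ reals $b(i),w(i)\ge0$ with $b(i)+w(i)\le 1$; the number of pebbles is $\sum_i(b(i)+w(i))$. Moves: (i) decrease any $b(i)$; (ii) increase any $w(i)$; (iii) if every child of $i$ has $b+w=1$ (vacuous for leaves), set $w(i)=0$, increase $b(i)$ arbitrarily, and simultaneously decrease the black values of the children of $i$ arbitrarily. A fractional pebbling using $p$ pebbles is a sequence of moves starting and ending with all values $0$, such that every sink has black value $1$ at some point, and no configuration exceeds $p$ pebbles. A whole black-white pebbling is a fractional pebbling in which all $b(i),w(i)$ are always in $\{0,1\}$. *)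

theory Defs
  imports Complex_Main
begin

text \<open>A directed graph is a vertex set \<open>V\<close> together with an edge relation \<open>E\<close>, where
  \<open>(j, i) \<in> E\<close> is an edge from \<open>j\<close> to \<open>i\<close>. The orientation is towards the roots: edges
  lead from children to parents, so leaves are sources and roots are sinks.\<close>

definition finite_dag :: "'a set \<Rightarrow> 'a rel \<Rightarrow> bool" where
  "finite_dag V E \<longleftrightarrow> finite V \<and> E \<subseteq> V \<times> V \<and> acyclic E"

definition children :: "'a rel \<Rightarrow> 'a \<Rightarrow> 'a set" where
  "children E i = {j. (j, i) \<in> E}"

definition sinks :: "'a set \<Rightarrow> 'a rel \<Rightarrow> 'a set" where
  "sinks V E = {i \<in> V. \<forall>j. (i, j) \<notin> E}"

record 'a config =
  black :: "'a \<Rightarrow> real"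
  white :: "'a \<Rightarrow> real"

text \<open>Only the values of a configuration on \<open>V\<close> are meaningful; everything below ignores the
  values outside \<open>V\<close>.\<close>

definition valid_config :: "'a set \<Rightarrow> 'a config \<Rightarrow> bool" where
  "valid_config V c \<longleftrightarrow>
     (\<forall>i\<in>V. 0 \<le> black c i \<and> 0 \<le> white c i \<and> black c i + white c i \<le> 1)"

definition whole_config :: "'a set \<Rightarrow> 'a config \<Rightarrow> bool" where
  "whole_config V c \<longleftrightarrow> (\<forall>i\<in>V. black c i \<in> {0, 1} \<and> white c i \<in> {0, 1})"

definition zero_config :: "'a set \<Rightarrow> 'a config \<Rightarrow> bool" where
  "zero_config V c \<longleftrightarrow> (\<forall>i\<in>V. black c i = 0 \<and> white c i = 0)"

definition pebbles :: "'a set \<Rightarrow> 'a config \<Rightarrow> real" where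
  "pebbles V c = (\<Sum>i\<in>V. black c i + white c i)"

text \<open>Increases and decreases are not required to be strict: in the third move, ``arbitrarily''
  includes leaving a value unchanged (e.g. removing a white pebble without placing a black one),
  and in the first two moves this merely allows a configuration to be repeated.\<close>

definition decrease_black :: "'a set \<Rightarrow> 'a \<Rightarrow> 'a config \<Rightarrow> 'a config \<Rightarrow> bool" where
  "decrease_black V i c c' \<longleftrightarrow>
     black c' i \<le> black c i \<and>
     (\<forall>j\<in>V - {i}. black c' j = black c j) \<and>
     (\<forall>j\<in>V. white c' j = white c j)"

definition increase_white :: "'a set \<Rightarrow> 'a \<Rightarrow> 'a config \<Rightarrow> 'a config \<Rightarrow> bool" where
  "increase_white V i c c' \<longleftrightarrow>
     white c i \<le> white c' i \<and>
     (\<forall>j\<in>V - {i}. white c' j = white c j) \<and>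
     (\<forall>j\<in>V. black c' j = black c j)"

definition pebble_node :: "'a set \<Rightarrow> 'a rel \<Rightarrow> 'a \<Rightarrow> 'a config \<Rightarrow> 'a config \<Rightarrow> bool" where
  "pebble_node V E i c c' \<longleftrightarrow>
     (\<forall>j\<in>children E i. black c j + white c j = 1) \<and>
     white c' i = 0 \<and> black c i \<le> black c' i \<and>
     (\<forall>j\<in>children E i. black c' j \<le> black c j) \<and>
     (\<forall>j\<in>V - {i} - children E i. black c' j = black c j) \<and>
     (\<forall>j\<in>V - {i}. white c' j = white c j)"

definition move :: "'a set \<Rightarrow> 'a rel \<Rightarrow> 'a config \<Rightarrow> 'a config \<Rightarrow> bool" where
  "move V E c c' \<longleftrightarrow>
     (\<exists>i\<in>V. decrease_black V i c c' \<or> increase_white V i c c' \<or> pebble_node V E i c c')"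

text \<open>A pebbling is given by the nonempty list of all configurations it passes through.\<close>

definition fractional_pebbling :: "'a set \<Rightarrow> 'a rel \<Rightarrow> real \<Rightarrow> 'a config list \<Rightarrow> bool" where
  "fractional_pebbling V E p cs \<longleftrightarrow>
     cs \<noteq> [] \<and>
     (\<forall>c\<in>set cs. valid_config V c) \<and>
     zero_config V (hd cs) \<and> zero_config V (last cs) \<and>
     (\<forall>t. Suc t < length cs \<longrightarrow> move V E (cs ! t) (cs ! Suc t)) \<and>
     (\<forall>i\<in>sinks V E. \<exists>c\<in>set cs. black c i = 1) \<and>
     (\<forall>c\<in>set cs. pebbles V c \<le> p)"

definition whole_pebbling :: "'a set \<Rightarrow> 'a rel \<Rightarrow> real \<Rightarrow> 'a config list \<Rightarrow> bool" where
  "whole_pebbling V E p cs \<longleftrightarrow>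
     fractional_pebbling V E p cs \<and> (\<forall>c\<in>set cs. whole_config V c)"

end

(* Rounding each value at the threshold 1/2 (black values of 1/2 up, white ones down) at most
   doubles the pebble count. A node with b + w = 1 has exactly one pebble after rounding, and
   rounding is monotone, so each fractional move becomes a whole move of the same kind. *)
theory Submission
  imports Defs
begin

text \<open>Only the white test is strict, to settle the tie: a node with both values 1/2 must round
  to exactly one pebble. Two non-strict tests would give it two, two strict ones none.\<close>

definition round_config :: "'a config \<Rightarrow> 'a config" where
  "round_config c =
     \<lparr>black = (\<lambda>i. if black c i \<ge> 1/2 then 1 else 0),
      white = (\<lambda>i. if white c i > 1/2 then 1 else 0)\<rparr>"

text \<open>The two values at a node cannot both round up, since they would then sum to more than
  1.\<close>

lemma valid_round_config:
  assumes "valid_config V c"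
  shows "valid_config V (round_config c)"
  unfolding valid_config_def
proof
  fix i assume "i \<in> V"
  with assms have "black c i + white c i \<le> 1"
    by (simp add: valid_config_def)
  then show "0 \<le> black (round_config c) i \<and> 0 \<le> white (round_config c) i \<and>
      black (round_config c) i + white (round_config c) i \<le> 1"
    by (simp add: round_config_def)
qed

lemma whole_round_config: "whole_config V (round_config c)"
  by (simp add: whole_config_def round_config_def)

lemma zero_round_config:
  assumes "zero_config V c"
  shows "zero_config V (round_config c)"
  using assms by (simp add: zero_config_def round_config_def)

text \<open>Holds node by node: a value that becomes 1 was at least 1/2, and one that becomes 0 was
  nonnegative.\<close>

lemma pebbles_round_config:
  assumes "valid_config V c"
  shows "pebbles V (round_config c) \<le> 2 * pebbles V c"
  unfolding pebbles_def sum_distrib_left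
proof (rule sum_mono)
  fix i assume "i \<in> V"
  with assms have "0 \<le> black c i" "0 \<le> white c i" "black c i + white c i \<le> 1"
    by (auto simp: valid_config_def)
  then show "black (round_config c) i + white (round_config c) i \<le> 2 * (black c i + white c i)"
    by (simp add: round_config_def)
qed

lemma pebble_node_round_config:
  assumes "pebble_node V E i c c'"
  shows "pebble_node V E i (round_config c) (round_config c')"
proof -
  have "black (round_config c) j + white (round_config c) j = 1" if "j \<in> children E i" for j
  proof -
    have "black c j + white c j = 1"
      using assms that by (simp add: pebble_node_def)
    \<comment> \<open>Since the sum is 1, \<open>white c j > 1/2\<close> holds exactly when
      \<open>black c j \<ge> 1/2\<close> fails.\<close>
    then show ?thesis
      by (simp add: round_config_def)
  qed
  moreover have "black (round_config c') j \<le> black (round_config c) j"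
    if "j \<in> children E i" for j
  proof -
    have "black c' j \<le> black c j"
      using assms that by (simp add: pebble_node_def)
    then show ?thesis
      by (simp add: round_config_def)
  qed
  ultimately show ?thesis
    using assms by (simp add: pebble_node_def) (simp add: round_config_def)
qed

text \<open>If the value does not cross the threshold, the rounded configuration stays the same on
  \<open>V\<close>; this is still a move, as decreases need not be strict.\<close>

lemma decrease_black_round_config:
  assumes "decrease_black V i c c'"
  shows "decrease_black V i (round_config c) (round_config c')"
  using assms by (simp add: decrease_black_def round_config_def)

lemma increase_white_round_config:
  assumes "increase_white V i c c'"
  shows "increase_white V i (round_config c) (round_config c')"
  using assms by (simp add: increase_white_def round_config_def)

lemma move_round_config:
  assumes "move V E c c'"
  shows "move V E (round_config c) (round_config c')"
  using assms decrease_black_round_config increase_white_round_config pebble_node_round_config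
  unfolding move_def by metis

text \<open>Each configuration is rounded on its own and each move yields a single move, so no
  intermediate configurations have to be inserted.\<close>

lemma whole_pebbling_round_config:
  assumes "fractional_pebbling V E p cs"
  shows "whole_pebbling V E (2 * p) (map round_config cs)"
proof -
  have "pebbles V (round_config c) \<le> 2 * p" if "c \<in> set cs" for c
  proof -
    have "valid_config V c" "pebbles V c \<le> p"
      using that assms by (simp_all add: fractional_pebbling_def)
    then show ?thesis
      using pebbles_round_config[of V c] by linarith
  qed
  moreover have "\<exists>c\<in>set cs. black (round_config c) i = 1" if "i \<in> sinks V E" for i
  proof -
    have "\<exists>c\<in>set cs. black c i = 1"
      using that assms by (simp add: fractional_pebbling_def)
    then obtain c where "c \<in> set cs" "black c i = 1" ..
    \<comment> \<open>A full black pebble survives rounding, so the sink is pebbled at the same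
      moment as before.\<close>
    then have "black (round_config c) i = 1"
      by (simp add: round_config_def)
    with \<open>c \<in> set cs\<close> show ?thesis ..
  qed
  ultimately show ?thesis
    using assms
    by (simp add: whole_pebbling_def fractional_pebbling_def whole_round_config
        valid_round_config zero_round_config move_round_config hd_map last_map)
qed

theorem theorem4p3:
  fixes V :: "'a set" and E :: "'a rel" and p :: real
  assumes "finite_dag V E"
    and "\<exists>cs. fractional_pebbling V E p cs"
  shows "\<exists>cs. whole_pebbling V E (2 * p) cs"
  using assms(2) whole_pebbling_round_config by blast

end
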